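(* No (finite) tree $T$ has a subtree polynomial $\Phi_T$ with a real root in the interval $[-1,0)$.
   Context: For a finite tree $T$ of order $n$, $s_k(T)$ denotes the number of subtrees (connected induced subgraphs) of $T$ of order $k$, and the subtree polynomial of $T$ is $\Phi_T(x)=\sum_{k=1}^n s_k(T)x^k$. *)

theory Defs
  imports "Graph_Theory.Graph_Theory" "HOL-Computational_Algebra.Polynomial"
begin

text \<open>
  Finite simple undirected graphs are the finite, loop-free symmetric digraphs without parallel
  arcs of the locale \<^locale>\<open>graph\<close>: every edge is a pair of opposite arcs. Hence traversing an
  edge back and forth is a directed cycle of length 2, and the predicate
  \<^const>\<open>Digraph_Component.tree\<close>, which forbids all directed cycles, would only admit the
  one-vertex tree here. The undirected cycles are the directed cycles of length at least 3.
\<close>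

definition undirected_cycle :: "('a, 'b) pre_digraph \<Rightarrow> 'b awalk \<Rightarrow> bool" where
  "undirected_cycle G p \<longleftrightarrow> pre_digraph.cycle G p \<and> 3 \<le> length p"

definition finite_tree :: "('a, 'b) pre_digraph \<Rightarrow> bool" where
  "finite_tree T \<longleftrightarrow>
     graph T \<and> Digraph_Component.connected T \<and> \<not> (\<exists>p. undirected_cycle T p)"

text \<open>
  \<^const>\<open>Digraph_Component.connected\<close> requires a nonempty vertex set, so neither trees nor subtrees
  are empty. The arcs of an induced subgraph are determined by its vertices, so each connected
  vertex set is counted once.
\<close>

definition subtrees :: "('a, 'b) pre_digraph \<Rightarrow> ('a, 'b) pre_digraph set" where
  "subtrees T = {H. induced_subgraph H T \<and> Digraph_Component.connected H}"

definition num_subtrees :: "('a, 'b) pre_digraph \<Rightarrow> nat \<Rightarrow> nat" where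
  "num_subtrees T k = card {H \<in> subtrees T. card (verts H) = k}"

definition subtree_poly :: "('a, 'b) pre_digraph \<Rightarrow> real poly" where
  "subtree_poly T = (\<Sum>k = 1..card (verts T). monom (real (num_subtrees T k)) k)"

end

theory Submission
  imports Defs
begin

text \<open>
  Give every vertex \<open>v\<close> a weight \<open>w v\<close> in \<open>[-1, 0]\<close> and every connected vertex set the product of
  its weights; the constant weight \<open>x\<close> turns the total weight into the value of the subtree
  polynomial at \<open>x\<close>. Let \<open>l\<close> be a leaf with neighbour \<open>u\<close>. A connected set containing \<open>l\<close> is either
  \<open>{l}\<close> or arises by adding \<open>l\<close> to a connected set containing \<open>u\<close>, so deleting \<open>l\<close> and
  multiplying the weight of \<open>u\<close> by \<open>1 + w l\<close> (which keeps it in \<open>[-1, 0]\<close>) decreases the total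
  weight by exactly \<open>w l\<close>. By induction the total weight is at most the weight of some vertex.
\<close>

section \<open>Connected vertex sets and their total weight\<close>

text \<open>The relation stays fixed while the vertex set varies, so deleting a leaf changes only
  the set; \<open>rtrancl_on\<close> confines whole walks to \<open>S\<close>.\<close>

definition connected_set :: "'a rel \<Rightarrow> 'a set \<Rightarrow> bool" where
  "connected_set R S \<longleftrightarrow> S \<noteq> {} \<and> (\<forall>x\<in>S. \<forall>y\<in>S. (x, y) \<in> rtrancl_on S R)"

definition connected_subsets :: "'a rel \<Rightarrow> 'a set \<Rightarrow> 'a set set" where
  "connected_subsets R V = {S. S \<subseteq> V \<and> connected_set R S}"

text \<open>Weights depend on the vertex because the leaf reduction alters the weight of a single
  vertex; a constant weight would not survive it.\<close>

definition connected_weight :: "'a rel \<Rightarrow> ('a \<Rightarrow> 'b::comm_ring_1) \<Rightarrow> 'a set \<Rightarrow> 'b" where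
  "connected_weight R w V = (\<Sum>S\<in>connected_subsets R V. \<Prod>v\<in>S. w v)"

text \<open>This form opens trees to rule induction: acyclicity enters only as the uniqueness of the
  neighbour at each attachment.\<close>

inductive leaf_built :: "'a rel \<Rightarrow> 'a set \<Rightarrow> bool" for R where
  singleton: "leaf_built R {r}"
| add_leaf: "leaf_built R (insert l W)"
  if "leaf_built R W" "l \<notin> W" "u \<in> W" "(u, l) \<in> R" "\<And>v. v \<in> W \<Longrightarrow> (v, l) \<in> R \<Longrightarrow> v = u"

lemma finite_connected_subsets: "finite V \<Longrightarrow> finite (connected_subsets R V)"
  by (rule finite_subset[of _ "Pow V"]) (auto simp: connected_subsets_def)

lemma connected_set_singleton: "connected_set R {v}"
  by (simp add: connected_set_def)

text \<open>A walk that visits \<open>l\<close> on its way enters and leaves it through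
  \<open>u\<close>, so the detour can be cut out.\<close>

lemma connected_set_insert_leaf:
  assumes "sym R" and l: "l \<notin> S" and ul: "(u, l) \<in> R"
    and leaf: "\<And>v. v \<in> S \<Longrightarrow> (v, l) \<in> R \<Longrightarrow> v = u"
  shows "connected_set R (insert l S) \<longleftrightarrow> S = {} \<or> u \<in> S \<and> connected_set R S"
proof (cases "S = {}")
  case True
  then show ?thesis by (simp add: connected_set_singleton)
next
  case False
  have lu: "(l, u) \<in> R" using ul \<open>sym R\<close> by (meson symE)
  show ?thesis
  proof
    assume conn: "connected_set R (insert l S)"
    \<comment> \<open>The induction also needs a claim for walks that currently stand at
      \<open>l\<close>: they came from \<open>u\<close>, already reached within \<open>S\<close>,
      and can only return there.\<close>
    have reach: "if z = l then u \<in> S \<and> (x, u) \<in> rtrancl_on S R else (x, z) \<in> rtrancl_on S R"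
      if "(x, z) \<in> rtrancl_on (insert l S) R" "x \<in> S" for x z
      using that(1)
    proof (induction rule: rtrancl_on_induct)
      case base
      then show ?case using that(2) l by auto
    next
      case (step y z)
      show ?case
      proof (cases "z = l")
        case True
        then show ?thesis
          using step leaf[of y] by (auto split: if_splits dest: in_rtrancl_on_in_F)
      next
        case zl: False
        show ?thesis
        proof (cases "y = l")
          case True
          then have "(z, l) \<in> R" using step.hyps \<open>sym R\<close> by (meson symE)
          then have "z = u" using leaf[of z] zl step.hyps by auto
          then show ?thesis using True zl step.IH by auto
        next
          case False
          then show ?thesis
            using zl step.hyps step.IH by (auto intro: rtrancl_on_into_rtrancl_on)
        qed
      qed
    qed
    from False obtain s where "s \<in> S" by blast
    with conn have "(s, l) \<in> rtrancl_on (insert l S) R"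
      by (simp add: connected_set_def)
    from reach[OF this \<open>s \<in> S\<close>] have "u \<in> S" by simp
    moreover have "(x, y) \<in> rtrancl_on S R" if "x \<in> S" "y \<in> S" for x y
    proof -
      have "(x, y) \<in> rtrancl_on (insert l S) R"
        using conn that by (simp add: connected_set_def)
      from reach[OF this \<open>x \<in> S\<close>] show ?thesis using that l by (auto split: if_splits)
    qed
    ultimately show "S = {} \<or> u \<in> S \<and> connected_set R S"
      using False by (simp add: connected_set_def)
  next
    assume "S = {} \<or> u \<in> S \<and> connected_set R S"
    then have u: "u \<in> S" and conn: "connected_set R S" using False by auto
    have mono: "rtrancl_on S R \<subseteq> rtrancl_on (insert l S) R"
      by (auto intro: rtrancl_on_mono[of R R S])
    \<comment> \<open>\<open>u\<close> serves as a hub through which any two vertices are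
      joined.\<close>
    have to_u: "(x, u) \<in> rtrancl_on (insert l S) R \<and> (u, x) \<in> rtrancl_on (insert l S) R"
      if "x \<in> insert l S" for x
    proof (cases "x = l")
      case True
      have "(u, u) \<in> rtrancl_on (insert l S) R" using u by simp
      then show ?thesis
        using True ul lu by (auto intro: rtrancl_on_into_rtrancl_on converse_rtrancl_on_into_rtrancl_on)
    next
      case False
      then show ?thesis using that u conn mono by (auto simp: connected_set_def)
    qed
    then have "(x, y) \<in> rtrancl_on (insert l S) R" if "x \<in> insert l S" "y \<in> insert l S" for x y
      using that by (meson rtrancl_on_trans)
    then show "connected_set R (insert l S)"
      unfolding connected_set_def by blast
  qed
qed

text \<open>For a connected \<open>S\<close> containing \<open>u\<close>, the products over
  \<open>S\<close> and \<open>insert l S\<close> add up to \<open>1 + w l\<close> times the former.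
  This factor is absorbed by the weight of \<open>u\<close>; the set \<open>{l}\<close> leaves the
  separate term \<open>w l\<close>.\<close>

lemma connected_weight_insert_leaf:
  fixes w :: "'a \<Rightarrow> 'b::comm_ring_1"
  assumes "sym R" "finite W" and l: "l \<notin> W" and u: "u \<in> W" "(u, l) \<in> R"
    and leaf: "\<And>v. v \<in> W \<Longrightarrow> (v, l) \<in> R \<Longrightarrow> v = u"
  shows "connected_weight R w (insert l W) =
    w l + connected_weight R (w(u := w u * (1 + w l))) W"
proof -
  let ?C = "connected_subsets R W"
  let ?D = "{S \<in> ?C. u \<in> S}"
  let ?p = "\<lambda>S. \<Prod>v\<in>S. w v"
  have fin: "finite ?C" using assms by (simp add: finite_connected_subsets)
  have sub: "S \<subseteq> W" "l \<notin> S" "finite S" if "S \<in> ?C" for S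
    using that l finite_subset[OF _ \<open>finite W\<close>] by (auto simp: connected_subsets_def)
  have ins: "connected_set R (insert l S) \<longleftrightarrow> S = {} \<or> u \<in> S \<and> connected_set R S"
    if "S \<subseteq> W" for S
    using that l by (intro connected_set_insert_leaf \<open>sym R\<close> u leaf) auto
  have decomp: "connected_subsets R (insert l W) = insert {l} (?C \<union> insert l ` ?D)"
  proof (intro equalityI subsetI)
    fix S assume "S \<in> connected_subsets R (insert l W)"
    then have S: "S \<subseteq> insert l W" "connected_set R S" by (auto simp: connected_subsets_def)
    show "S \<in> insert {l} (?C \<union> insert l ` ?D)"
    proof (cases "l \<in> S")
      case True
      then have eq: "S = insert l (S - {l})" by blast
      have "S - {l} \<subseteq> W" using S by blast
      with ins[of "S - {l}"] S eq
      have "S - {l} = {} \<or> S - {l} \<in> ?D" by (auto simp: connected_subsets_def)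
      with eq show ?thesis by (metis UnI2 image_eqI insertI1 insertI2)
    next
      case False
      then show ?thesis using S by (auto simp: connected_subsets_def)
    qed
  next
    fix S assume "S \<in> insert {l} (?C \<union> insert l ` ?D)"
    then show "S \<in> connected_subsets R (insert l W)"
      using ins by (auto simp: connected_subsets_def connected_set_singleton)
  qed
  have inj: "inj_on (insert l) ?D"
    using sub(2) by (auto simp: inj_on_def dest: insert_ident)
  have "{l} \<notin> ?C \<union> insert l ` ?D" using sub(2) u l by auto
  moreover have "?C \<inter> insert l ` ?D = {}" using sub(2) by auto
  ultimately have "connected_weight R w (insert l W) =
      w l + (sum ?p ?C + (\<Sum>S\<in>?D. ?p (insert l S)))"
    using fin inj by (simp add: connected_weight_def decomp sum.union_disjoint sum.reindex)
  also have "(\<Sum>S\<in>?D. ?p (insert l S)) = (\<Sum>S\<in>?C. if u \<in> S then w l * ?p S else 0)"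
    using fin sub by (simp add: sum.inter_filter[symmetric])
  also have "sum ?p ?C + \<dots> = (\<Sum>S\<in>?C. \<Prod>v\<in>S. (w(u := w u * (1 + w l))) v)"
    unfolding sum.distrib[symmetric]
  proof (rule sum.cong)
    fix S assume "S \<in> ?C"
    \<comment> \<open>If \<open>u\<close> is not in \<open>S\<close>, then \<open>S - {u}\<close> is
      \<open>S\<close>, so this equation serves both cases.\<close>
    have *: "(\<Prod>v\<in>S - {u}. (w(u := w u * (1 + w l))) v) = ?p (S - {u})"
      by (rule prod.cong) auto
    show "?p S + (if u \<in> S then w l * ?p S else 0) = (\<Prod>v\<in>S. (w(u := w u * (1 + w l))) v)"
    proof (cases "u \<in> S")
      case True
      then show ?thesis
        using sub(3)[OF \<open>S \<in> ?C\<close>] * by (simp add: prod.remove[of S u] algebra_simps)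
    next
      case False
      then show ?thesis using * by simp
    qed
  qed simp
  finally show ?thesis by (simp add: connected_weight_def)
qed

section \<open>Sets grown leaf by leaf and the weight bound\<close>

lemma leaf_built_finite: "leaf_built R W \<Longrightarrow> finite W"
  by (induction rule: leaf_built.induct) auto

lemma leaf_built_connected_set: "leaf_built R W \<Longrightarrow> sym R \<Longrightarrow> connected_set R W"
proof (induction rule: leaf_built.induct)
  case (add_leaf W l u)
  then show ?case using connected_set_insert_leaf[of R l W u] by blast
qed (rule connected_set_singleton)

text \<open>A reduced weight can become 0, for instance when \<open>w l = -1\<close>, so negative
  weights would not be preserved. The closed interval is, and the bound by an original weight
  restores strictness for negative weights.\<close>

lemma leaf_built_connected_weight_le:
  fixes w :: "'a \<Rightarrow> 'b::linordered_idom"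
  assumes "leaf_built R W" "sym R" "\<And>v. v \<in> W \<Longrightarrow> w v \<in> {-1..0}"
  shows "\<exists>v\<in>W. connected_weight R w W \<le> w v"
  using assms
proof (induction arbitrary: w rule: leaf_built.induct)
  case (singleton r)
  have "connected_subsets R {r} = {{r}}"
    by (auto simp: connected_subsets_def connected_set_singleton)
      (auto simp: connected_set_def)
  then show ?case by (simp add: connected_weight_def)
next
  case (add_leaf W l u)
  let ?w = "w(u := w u * (1 + w l))"
  have wl: "w l \<in> {-1..0}" and wu: "w u \<in> {-1..0}" using add_leaf.prems \<open>u \<in> W\<close> by simp_all
  have "0 \<le> - w u * (1 + w l)" using wl wu by (intro mult_nonneg_nonneg) auto
  moreover have "- w u * (1 + w l) \<le> 1 * 1" using wl wu by (intro mult_mono) auto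
  ultimately have "w u * (1 + w l) \<in> {-1..0}" by simp
  then have range: "?w v \<in> {-1..0}" if "v \<in> W" for v
    using add_leaf.prems that by simp
  then have "\<exists>v\<in>W. connected_weight R ?w W \<le> ?w v"
    by (rule add_leaf.IH[OF \<open>sym R\<close>])
  then obtain v where v: "v \<in> W" "connected_weight R ?w W \<le> ?w v" by (rule bexE)
  \<comment> \<open>Only nonpositivity is kept from the induction hypothesis; the new leaf
    \<open>l\<close> becomes the witness.\<close>
  have "?w v \<le> 0" using range[OF v(1)] by (simp only: atLeastAtMost_iff)
  with v(2) have "connected_weight R ?w W \<le> 0" by (rule order_trans)
  moreover have "connected_weight R w (insert l W) = w l + connected_weight R ?w W"
    using add_leaf.hyps add_leaf.prems(1)
    by (intro connected_weight_insert_leaf leaf_built_finite) assumption+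
  ultimately have "connected_weight R w (insert l W) \<le> w l" by simp
  then show ?case by blast
qed

section \<open>Subtrees and trees in terms of the adjacency relation\<close>

lemma rtrancl_on_Int_square: "rtrancl_on S (R \<inter> S \<times> S) = rtrancl_on S R"
proof (intro equalityI subrelI)
  fix x y assume "(x, y) \<in> rtrancl_on S R"
  then show "(x, y) \<in> rtrancl_on S (R \<inter> S \<times> S)"
    by (induction rule: rtrancl_on_induct) (auto intro: rtrancl_on_into_rtrancl_on)
qed (auto intro: rtrancl_on_mono[of "R \<inter> S \<times> S" R S])

context graph
begin

lemma sym_arcs_ends: "sym (arcs_ends G)"
  using sym_arcs by (simp add: symmetric_def)

text \<open>Connectedness of a digraph is strong connectedness of its symmetric closure, and the
  arcs here are symmetric already.\<close>

lemma connected_induce_subgraph_iff: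
  "Digraph_Component.connected (G \<restriction> S) \<longleftrightarrow> connected_set (arcs_ends G) S"
proof -
  have "arcs_ends (with_proj (mk_symmetric (G \<restriction> S))) = arcs_ends G \<inter> S \<times> S"
    using sym_arcs_ends by (auto simp: mk_symmetric_def arcs_ends_conv sym_def)
  then show ?thesis
    by (simp add: Digraph_Component.connected_def strongly_connected_def reachable_def
        connected_set_def rtrancl_on_Int_square)
qed

text \<open>A subgraph shares the \<open>tail\<close> and \<open>head\<close> functions of its host,
  so the vertex set determines \<open>H\<close> as a record. Counting subtrees thus becomes counting
  vertex sets.\<close>

lemma induced_subgraph_iff: "induced_subgraph H G \<longleftrightarrow> verts H \<subseteq> verts G \<and> H = G \<restriction> verts H"
proof
  assume "induced_subgraph H G"
  then show "verts H \<subseteq> verts G \<and> H = G \<restriction> verts H"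
    by (auto simp: induced_subgraph_def subgraph_def compatible_def induce_subgraph_def)
next
  assume "verts H \<subseteq> verts G \<and> H = G \<restriction> verts H"
  then show "induced_subgraph H G" by (metis induced_induce)
qed

lemma bij_betw_verts_subtrees:
  "bij_betw verts {H \<in> subtrees G. card (verts H) = k}
    {S \<in> connected_subsets (arcs_ends G) (verts G). card S = k}"
proof (rule bij_betw_byWitness[where f' = "induce_subgraph G"])
  show "\<forall>H\<in>{H \<in> subtrees G. card (verts H) = k}. G \<restriction> verts H = H"
    by (auto simp: subtrees_def induced_subgraph_iff)
  show "verts ` {H \<in> subtrees G. card (verts H) = k} \<subseteq>
      {S \<in> connected_subsets (arcs_ends G) (verts G). card S = k}"
    unfolding subtrees_def connected_subsets_def induced_subgraph_iff
    using connected_induce_subgraph_iff by auto metis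
qed (auto simp: subtrees_def connected_subsets_def induced_subgraph_iff
      connected_induce_subgraph_iff)

lemma poly_subtree_poly:
  "poly (subtree_poly G) x = connected_weight (arcs_ends G) (\<lambda>_. x) (verts G)"
proof -
  let ?C = "connected_subsets (arcs_ends G) (verts G)"
  have "card S \<in> {1..card (verts G)}" if "S \<in> ?C" for S
  proof -
    have "S \<subseteq> verts G" "S \<noteq> {}"
      using that by (auto simp: connected_subsets_def connected_set_def)
    then show ?thesis
      by (metis atLeastAtMost_iff card_gt_0_iff card_mono finite_subset finite_verts less_eq_Suc_le One_nat_def)
  qed
  then have "card ` ?C \<subseteq> {1..card (verts G)}" by blast
  \<comment> \<open>The connected sets are grouped by cardinality; each group yields one
    coefficient.\<close>
  then have "(\<Sum>S\<in>?C. x ^ card S) =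
      (\<Sum>k=1..card (verts G). \<Sum>S | S \<in> ?C \<and> card S = k. x ^ card S)"
    by (intro sum.group[symmetric]) (auto simp: finite_connected_subsets)
  also have "\<dots> = (\<Sum>k=1..card (verts G). real (num_subtrees G k) * x ^ k)"
    by (rule sum.cong) (simp_all add: num_subtrees_def bij_betw_same_card[OF bij_betw_verts_subtrees])
  finally show ?thesis
    by (simp add: subtree_poly_def connected_weight_def poly_sum poly_monom)
qed

text \<open>Two edges from outside into a connected set close up to a cycle through that set.\<close>

lemma unique_neighbour_in_connected_set:
  assumes acyclic: "\<not> (\<exists>p. undirected_cycle G p)"
    and W: "W \<subseteq> verts G" "connected_set (arcs_ends G) W" "l \<notin> W"
    and a: "a \<in> W" "(a, l) \<in> arcs_ends G" and b: "b \<in> W" "(b, l) \<in> arcs_ends G"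
  shows "a = b"
proof (rule ccontr)
  assume "a \<noteq> b"
  have "(a, b) \<in> rtrancl_on W (arcs_ends G)" using W a b by (simp add: connected_set_def)
  \<comment> \<open>Arcs with both ends in \<open>W\<close> keep the walk away from
    \<open>l\<close>.\<close>
  then have "\<exists>p. awalk a p b \<and> set p \<subseteq> arcs (G \<restriction> W)"
  proof (induction rule: rtrancl_on_induct)
    case base
    then show ?case using W by (intro exI[of _ "[]"]) (auto simp: awalk_Nil_iff)
  next
    case (step y z)
    then obtain p where p: "awalk a p y" "set p \<subseteq> arcs (G \<restriction> W)" by blast
    from step obtain e where e: "e \<in> arcs G" "tail G e = y" "head G e = z"
      by (auto simp: arcs_ends_conv)
    then have "awalk y [e] z" using arc_implies_awalk by blast
    with p have "awalk a (p @ [e]) z" by (blast intro: awalk_appendI)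
    then show ?case using p e step.hyps by (intro exI[of _ "p @ [e]"]) auto
  qed
  then obtain p0 where p0: "awalk a p0 b" "set p0 \<subseteq> arcs (G \<restriction> W)" by blast
  define p where "p = awalk_to_apath p0"
  have p: "apath a p b" "set p \<subseteq> arcs (G \<restriction> W)"
    using p0 apath_awalk_to_apath awalk_to_apath_subset unfolding p_def by blast+
  then have walk: "awalk a p b" and dist: "distinct (awalk_verts a p)" by (auto simp: apath_def)
  have inW: "set (awalk_verts a p) \<subseteq> W"
    using p(2) a(1) by (auto simp: set_awalk_verts[OF walk])
  have "p \<noteq> []" using walk \<open>a \<noteq> b\<close> by (auto simp: awalk_Nil_iff)
  from b obtain e where e: "e \<in> arcs G" "tail G e = b" "head G e = l"
    by (auto simp: arcs_ends_conv)
  have "(l, a) \<in> arcs_ends G" using a sym_arcs_ends by (meson symE)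
  then obtain f where f: "f \<in> arcs G" "tail G f = l" "head G f = a"
    by (auto simp: arcs_ends_conv)
  have "awalk l (f # p @ [e]) l"
    using walk e f head_in_verts[OF e(1)] by (simp add: awalk_simps)
  moreover have "awalk_verts a (p @ [e]) = awalk_verts a p @ [l]"
    using walk e by (subst awalk_verts_append[of a p "[e]" l]) (auto simp: awalk_simps)
  \<comment> \<open>The closed walk runs from \<open>l\<close> to \<open>a\<close>, through
    \<open>W\<close> to \<open>b\<close> and back; \<open>l\<close> stands at both ends, so only the
    tail of its vertex list is distinct.\<close>
  then have "distinct (tl (awalk_verts l (f # p @ [e])))"
    using dist inW \<open>l \<notin> W\<close> f by auto
  ultimately have "cycle (f # p @ [e])" unfolding cycle_def by blast
  \<comment> \<open>Since \<open>a \<noteq> b\<close>, the path \<open>p\<close> has an arc, so this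
    is no edge traversed back and forth.\<close>
  moreover have "3 \<le> length (f # p @ [e])" using \<open>p \<noteq> []\<close> by (cases p) auto
  ultimately show False using acyclic by (auto simp: undirected_cycle_def)
qed

text \<open>A maximal leaf-built set is closed under adjacency, since acyclicity lets any adjacent
  outside vertex be attached as a leaf. By connectedness it contains every vertex.\<close>

lemma tree_leaf_built:
  assumes conn: "Digraph_Component.connected G" and acyclic: "\<not> (\<exists>p. undirected_cycle G p)"
  shows "leaf_built (arcs_ends G) (verts G)"
proof -
  let ?R = "arcs_ends G"
  let ?A = "{W. W \<subseteq> verts G \<and> leaf_built ?R W}"
  have "G \<restriction> verts G = G" 
    using wellformed by (intro pre_digraph.equality) auto
  then have connV: "connected_set ?R (verts G)"
    using conn connected_induce_subgraph_iff[of "verts G"] by simp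
  then obtain r where "r \<in> verts G" by (auto simp: connected_set_def)
  then have "{r} \<in> ?A" by (simp add: leaf_built.singleton)
  then have nonempty: "?A \<noteq> {}" by (rule ex_in_conv[THEN iffD1, OF exI])
  have "finite ?A" by (rule finite_subset[of _ "Pow (verts G)"]) auto
  from finite_has_maximal[OF this nonempty]
  obtain W where "W \<in> ?A" and max: "\<forall>W'\<in>?A. W \<subseteq> W' \<longrightarrow> W = W'" by (rule bexE)
  then have W: "W \<subseteq> verts G" "leaf_built ?R W" by simp_all
  have connW: "connected_set ?R W" using W sym_arcs_ends by (simp add: leaf_built_connected_set)
  then obtain s where "s \<in> W" by (auto simp: connected_set_def)
  have closed: "l \<in> W" if "u \<in> W" "(u, l) \<in> ?R" "l \<in> verts G" for u l
  proof (rule ccontr)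
    assume "l \<notin> W"
    have "leaf_built ?R (insert l W)"
      using W(2) \<open>l \<notin> W\<close> that(1,2)
    proof (rule leaf_built.add_leaf)
      show "v = u" if "v \<in> W" "(v, l) \<in> ?R" for v
        using unique_neighbour_in_connected_set[OF acyclic W(1) connW \<open>l \<notin> W\<close>]
          that \<open>u \<in> W\<close> \<open>(u, l) \<in> ?R\<close> by blast
    qed
    then show False using max W(1) \<open>l \<notin> W\<close> \<open>l \<in> verts G\<close> by blast
  qed
  have "z \<in> W" if "z \<in> verts G" for z
  proof -
    have "(s, z) \<in> rtrancl_on (verts G) ?R"
      using connV \<open>s \<in> W\<close> W(1) that by (auto simp: connected_set_def)
    then show ?thesis
      by (induction rule: rtrancl_on_induct) (use \<open>s \<in> W\<close> closed in auto)
  qed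
  then have "W = verts G" using W(1) by blast
  with W(2) show ?thesis by simp
qed

end

theorem theorem3p2:
  fixes T :: "('a, 'b) pre_digraph"
  assumes "finite_tree T"
  shows "\<not> (\<exists>x::real. x \<in> {-1..<0} \<and> poly (subtree_poly T) x = 0)"
proof -
  interpret graph T using assms by (simp add: finite_tree_def)
  have "leaf_built (arcs_ends T) (verts T)"
    using assms by (intro tree_leaf_built) (auto simp: finite_tree_def)
  \<comment> \<open>Every witness has the constant weight \<open>x\<close>, so the value is at most
    \<open>x\<close> and hence negative.\<close>
  then have "poly (subtree_poly T) x \<le> x" if "x \<in> {-1..<0}" for x
    using leaf_built_connected_weight_le[of "arcs_ends T" "verts T" "\<lambda>_. x"] that sym_arcs_ends
    by (auto simp: poly_subtree_poly)
  then show ?thesis by force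
qed

end
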